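(* For every sequence of complex numbers $a=(a_{n_1,n_2}:n_1,n_2\in\mathbb{N}_0)$, all $s_1,s_2\in\mathbb{N}_0$, and any $n_1^0\in\{0,\dots,2^{s_1}-1\}$, $n_2^0\in\{0,\dots,2^{s_2}-1\}$, $$\begin{aligned} \sup_{0\le n_1<2^{s_1}}\ \sup_{0\le n_2<2^{s_2}}|a_{n_1,n_2}|\le{}& 8\sum_{i_1=0}^{s_1}\sum_{i_2=0}^{s_2}\Big(\sum_{j_1=1}^{2^{s_1-i_1}}\sum_{j_2=1}^{2^{s_2-i_2}}\Big|\sum_{k_1\in I^{i_1}_{j_1}}\sum_{k_2\in I^{i_2}_{j_2}}\Delta_{k_1,k_2}(a)\Big|^2\Big)^{1/2}\\ &+2\sqrt2\sum_{i_1=0}^{s_1}\Big(\sum_{j_1=1}^{2^{s_1-i_1}}\Big|\sum_{k_1\in I^{i_1}_{j_1}}\Delta^1_{k_1,n_2^0}(a)\Big|^2\Big)^{1/2}\\ &+2\sqrt2\sum_{i_2=0}^{s_2}\Big(\sum_{j_2=1}^{2^{s_2-i_2}}\Big|\sum_{k_2\in I^{i_2}_{j_2}}\Delta^2_{n_1^0,k_2}(a)\Big|^2\Big)^{1/2}+|a_{n_1^0,n_2^0}|. \end{aligned}$$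
   Context: $\mathbb{N}_0=\{0,1,2,\dots\}$. For integers $i\ge 0$ and $j\ge 1$, $I^i_j=\big((j-1)2^i,\,j2^i\big]$, and sums over $k\in I^i_j$ run over the integers in this interval. The suprema run over integers. The difference operators are $$\Delta^1_{n_1,n_2}(a)=a_{n_1,n_2}-a_{n_1-1,n_2},\qquad \Delta^2_{n_1,n_2}(a)=a_{n_1,n_2}-a_{n_1,n_2-1},$$ $$\Delta_{n_1,n_2}(a)=a_{n_1,n_2}-a_{n_1,n_2-1}-a_{n_1-1,n_2}+a_{n_1-1,n_2-1}.$$ *)

theory Defs
  imports Complex_Main
begin

text \<open>
  The convention \<open>I\<^sup>i\<^sub>j = ((j-1)2\<^sup>i, j2\<^sup>i]\<close> is for \<open>j \<ge> 1\<close>. Since then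
  the left endpoint is nonnegative, the integers in this interval are exactly the natural
  numbers in it.
\<close>
definition dyadic :: "nat \<Rightarrow> nat \<Rightarrow> nat set" where
  "dyadic i j = {(j - 1) * 2 ^ i <.. j * 2 ^ i}"

text \<open>
  The difference operators are meaningful only where the decremented indices are positive;
  at index 0 the subtraction on \<^typ>\<open>nat\<close> truncates. Every index taken from
  \<open>dyadic i j\<close> is positive.
\<close>
definition diff1 :: "(nat \<Rightarrow> nat \<Rightarrow> complex) \<Rightarrow> nat \<Rightarrow> nat \<Rightarrow> complex" where
  "diff1 a n1 n2 = a n1 n2 - a (n1 - 1) n2"

definition diff2 :: "(nat \<Rightarrow> nat \<Rightarrow> complex) \<Rightarrow> nat \<Rightarrow> nat \<Rightarrow> complex" where
  "diff2 a n1 n2 = a n1 n2 - a n1 (n2 - 1)"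

definition diff12 :: "(nat \<Rightarrow> nat \<Rightarrow> complex) \<Rightarrow> nat \<Rightarrow> nat \<Rightarrow> complex" where
  "diff12 a n1 n2 = a n1 n2 - a n1 (n2 - 1) - a (n1 - 1) n2 + a (n1 - 1) (n2 - 1)"

end

theory Submission
  imports Defs
begin

text \<open>
  Chopping off binary digits one at a time writes \<open>{0<..n}\<close> with \<open>n < 2\<^sup>s\<close> as a disjoint union
  of at most one dyadic interval from each level \<open>i < s\<close>, so a partial sum over \<open>{0<..n}\<close>
  is a sum of one dyadic sum per level, and each of these is dominated by the
  \<open>\<ell>\<^sup>2\<close>-norm of all dyadic sums of that level. The difference of \<open>a\<close> between two points is a
  combination of two such partial sums in one variable and of four in two variables; this gives
  the theorem even with constants \<open>4\<close> and \<open>2\<close> in place of \<open>8\<close> and \<open>2 * sqrt 2\<close>.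
\<close>

text \<open>The endpoints are \<open>n\<close> with its lowest \<open>i + 1\<close>, respectively
  \<open>i\<close>, binary digits set to zero. So the block has \<open>2 ^ i\<close> elements if
  digit \<open>i\<close> of \<open>n\<close> is 1 and is empty if that digit is 0.\<close>

definition digit_block :: "nat \<Rightarrow> nat \<Rightarrow> nat set" where
  "digit_block i n = {n div 2 ^ Suc i * 2 ^ Suc i <.. n div 2 ^ i * 2 ^ i}"

text \<open>Puts both endpoints of a block on the scale \<open>2 ^ i\<close>, so that the parity of
  \<open>n div 2 ^ i\<close> decides its shape.\<close>

lemma div_mult_power_two_Suc:
  "n div 2 ^ Suc i * 2 ^ Suc i = (n div 2 ^ i div 2 * 2) * (2 ^ i :: nat)"
  by (simp add: power_Suc2 div_mult2_eq del: power_Suc)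

lemma digit_block_eq_dyadic:
  assumes "odd (n div 2 ^ i)"
  shows "digit_block i n = dyadic i (n div 2 ^ i)"
proof -
  have "n div 2 ^ i div 2 * 2 = n div 2 ^ i - 1"
    using assms by (metis odd_two_times_div_two_nat mult.commute)
  then show ?thesis
    by (simp only: digit_block_def dyadic_def div_mult_power_two_Suc)
qed

lemma digit_block_empty:
  assumes "even (n div 2 ^ i)"
  shows "digit_block i n = {}"
proof -
  have "n div 2 ^ i div 2 * 2 = n div 2 ^ i"
    using assms by simp
  then show ?thesis
    by (simp only: digit_block_def div_mult_power_two_Suc greaterThanAtMost_empty order_refl)
qed

text \<open>The range of \<open>j\<close> is that of the level \<open>i\<close> sums in the theorem:
  oddness of \<open>n div 2 ^ i\<close> gives the lower bound 1, and \<open>n < 2 ^ s\<close> gives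
  the upper one.\<close>

lemma digit_block_cases:
  assumes "n < 2 ^ s" "i < s"
  obtains "digit_block i n = {}"
  | j where "j \<in> {1..2 ^ (s - i)}" "digit_block i n = dyadic i j"
proof (cases "even (n div 2 ^ i)")
  case True
  then show ?thesis using that(1) digit_block_empty by blast
next
  case False
  have "n < 2 ^ (s - i) * 2 ^ i"
    using assms by (simp flip: power_add)
  then have "n div 2 ^ i < 2 ^ (s - i)"
    by (simp add: less_mult_imp_div_less)
  with False have "n div 2 ^ i \<in> {1..2 ^ (s - i)}"
    by (auto simp: Suc_le_eq intro: Nat.gr0I)
  then show ?thesis using that(2) digit_block_eq_dyadic[OF False] by blast
qed

lemma sum_digit_blocks:
  fixes f :: "nat \<Rightarrow> 'a::comm_monoid_add"
  assumes "n < 2 ^ s"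
  shows "sum f {0<..n} = (\<Sum>i<s. sum f (digit_block i n))"
proof -
  \<comment> \<open>For the induction the claim is freed of \<open>n < 2 ^ s\<close>: passing to
    \<open>Suc s\<close> lowers the left endpoint and adds exactly \<open>digit_block s n\<close>
    there. The bound on \<open>n\<close> finally makes the left endpoint 0.\<close>
  have "sum f {n div 2 ^ s * 2 ^ s<..n} = (\<Sum>i<s. sum f (digit_block i n))"
  proof (induction s)
    case (Suc s)
    have "n div 2 ^ Suc s * 2 ^ Suc s \<le> n div 2 ^ s * 2 ^ s"
      unfolding div_mult_power_two_Suc by (intro mult_right_mono) auto
    then have "{n div 2 ^ Suc s * 2 ^ Suc s<..n}
        = {n div 2 ^ s * 2 ^ s<..n} \<union> digit_block s n"
      unfolding digit_block_def
      by (subst Un_commute, subst ivl_disj_un_two(6)) auto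
    moreover have "{n div 2 ^ s * 2 ^ s<..n} \<inter> digit_block s n = {}"
      by (auto simp: digit_block_def)
    ultimately show ?case
      by (simp add: sum.union_disjoint Suc.IH digit_block_def del: power_Suc)
  qed simp
  with assms show ?thesis by simp
qed

lemma sum_telescope_greaterThanAtMost:
  fixes f :: "nat \<Rightarrow> 'a::ab_group_add"
  shows "(\<Sum>k\<in>{0<..n}. f k - f (k - 1)) = f n - f 0"
proof (induction n)
  case (Suc n)
  have "{0<..Suc n} = insert (Suc n) {0<..n}" by auto
  with Suc show ?case by simp
qed simp

lemma norm_le_sqrt_sum_squares:
  fixes x :: "'b \<Rightarrow> 'a::real_normed_vector"
  assumes "finite J" "j \<in> J"
  shows "norm (x j) \<le> sqrt (\<Sum>j\<in>J. (norm (x j))\<^sup>2)"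
  by (rule real_le_rsqrt, rule member_le_sum) (use assms in auto)

lemma norm_sum_digit_block_le:
  fixes f :: "nat \<Rightarrow> 'a::real_normed_vector"
  assumes "n < 2 ^ s" "i < s"
  shows "norm (sum f (digit_block i n))
    \<le> sqrt (\<Sum>j = 1..2 ^ (s - i). (norm (sum f (dyadic i j)))\<^sup>2)"
  using assms
proof (cases rule: digit_block_cases)
  case (2 j)
  then show ?thesis
    using norm_le_sqrt_sum_squares[of "{1..2 ^ (s - i)}" j "\<lambda>j. sum f (dyadic i j)"] by simp
qed (simp add: sum_nonneg)

lemma norm_sum_digit_block_le2:
  fixes f :: "nat \<Rightarrow> nat \<Rightarrow> 'a::real_normed_vector"
  assumes "n1 < 2 ^ s1" "i1 < s1" "n2 < 2 ^ s2" "i2 < s2"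
  shows "norm (\<Sum>k1\<in>digit_block i1 n1. \<Sum>k2\<in>digit_block i2 n2. f k1 k2)
    \<le> sqrt (\<Sum>j1 = 1..2 ^ (s1 - i1). \<Sum>j2 = 1..2 ^ (s2 - i2).
        (norm (\<Sum>k1\<in>dyadic i1 j1. \<Sum>k2\<in>dyadic i2 j2. f k1 k2))\<^sup>2)"
    (is "_ \<le> ?R")
proof (rule digit_block_cases[OF assms(1,2)])
  assume "digit_block i1 n1 = {}"
  then show ?thesis by (simp add: sum_nonneg)
next
  fix j1 assume j1: "j1 \<in> {1..2 ^ (s1 - i1)}" "digit_block i1 n1 = dyadic i1 j1"
  show ?thesis
  proof (rule digit_block_cases[OF assms(3,4)])
    assume "digit_block i2 n2 = {}"
    then show ?thesis by (simp add: sum_nonneg)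
  next
    fix j2 assume j2: "j2 \<in> {1..2 ^ (s2 - i2)}" "digit_block i2 n2 = dyadic i2 j2"
    show ?thesis
      \<comment> \<open>The double sum of squares is read as one sum over pairs, in which the
        rectangle \<open>(j1, j2)\<close> is a single term.\<close>
      using norm_le_sqrt_sum_squares[of "{1..2 ^ (s1 - i1)} \<times> {1..2 ^ (s2 - i2)}" "(j1, j2)"
          "\<lambda>(j1, j2). \<Sum>k1\<in>dyadic i1 j1. \<Sum>k2\<in>dyadic i2 j2. f k1 k2"] j1 j2
      by (simp add: sum.cartesian_product split_def)
  qed
qed

lemma norm_partial_sum_le:
  fixes f :: "nat \<Rightarrow> 'a::real_normed_vector"
  assumes "n < 2 ^ s"
  shows "norm (sum f {0<..n})
    \<le> (\<Sum>i = 0..s. sqrt (\<Sum>j = 1..2 ^ (s - i). (norm (sum f (dyadic i j)))\<^sup>2))"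
    (is "_ \<le> sum ?S _")
proof -
  have "norm (sum f {0<..n}) \<le> (\<Sum>i<s. ?S i)"
    unfolding sum_digit_blocks[OF assms]
    by (rule sum_norm_le) (use assms norm_sum_digit_block_le in auto)
  \<comment> \<open>The blocks have levels below \<open>s\<close>; the summand at level
    \<open>s\<close> is nonnegative and may be added.\<close>
  also have "\<dots> \<le> sum ?S {0..s}"
    by (rule sum_mono2) (auto intro!: sum_nonneg)
  finally show ?thesis .
qed

lemma norm_partial_sum_le2:
  fixes f :: "nat \<Rightarrow> nat \<Rightarrow> 'a::real_normed_vector"
  assumes "n1 < 2 ^ s1" "n2 < 2 ^ s2"
  shows "norm (\<Sum>k1\<in>{0<..n1}. \<Sum>k2\<in>{0<..n2}. f k1 k2)
    \<le> (\<Sum>i1 = 0..s1. \<Sum>i2 = 0..s2.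
        sqrt (\<Sum>j1 = 1..2 ^ (s1 - i1). \<Sum>j2 = 1..2 ^ (s2 - i2).
          (norm (\<Sum>k1\<in>dyadic i1 j1. \<Sum>k2\<in>dyadic i2 j2. f k1 k2))\<^sup>2))"
    (is "_ \<le> (\<Sum>i1 = 0..s1. \<Sum>i2 = 0..s2. ?S i1 i2)")
proof -
  have "(\<Sum>k1\<in>{0<..n1}. \<Sum>k2\<in>{0<..n2}. f k1 k2)
      = (\<Sum>i1<s1. \<Sum>k1\<in>digit_block i1 n1. \<Sum>i2<s2. \<Sum>k2\<in>digit_block i2 n2. f k1 k2)"
    by (simp add: sum_digit_blocks[OF assms(1)] sum_digit_blocks[OF assms(2)])
  \<comment> \<open>With both level sums outside, the triangle inequality leaves sums over products
    of two blocks, each a dyadic rectangle or empty.\<close>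
  also have "\<dots>
      = (\<Sum>i1<s1. \<Sum>i2<s2. \<Sum>k1\<in>digit_block i1 n1. \<Sum>k2\<in>digit_block i2 n2. f k1 k2)"
    by (rule sum.cong[OF refl], rule sum.swap)
  finally have "norm (\<Sum>k1\<in>{0<..n1}. \<Sum>k2\<in>{0<..n2}. f k1 k2)
      \<le> (\<Sum>i1<s1. norm (\<Sum>i2<s2.
            \<Sum>k1\<in>digit_block i1 n1. \<Sum>k2\<in>digit_block i2 n2. f k1 k2))"
    by (simp only: norm_sum)
  also have "\<dots> \<le> (\<Sum>i1<s1. \<Sum>i2 = 0..s2. ?S i1 i2)"
  proof (rule sum_mono)
    fix i1 assume i1: "i1 \<in> {..<s1}"
    have "norm (\<Sum>i2<s2. \<Sum>k1\<in>digit_block i1 n1. \<Sum>k2\<in>digit_block i2 n2. f k1 k2)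
        \<le> (\<Sum>i2<s2. ?S i1 i2)"
      by (rule sum_norm_le, rule norm_sum_digit_block_le2) (use assms i1 in auto)
    also have "\<dots> \<le> (\<Sum>i2 = 0..s2. ?S i1 i2)"
      by (rule sum_mono2) (auto intro!: sum_nonneg)
    finally show "norm (\<Sum>i2<s2. \<Sum>k1\<in>digit_block i1 n1. \<Sum>k2\<in>digit_block i2 n2. f k1 k2)
        \<le> (\<Sum>i2 = 0..s2. ?S i1 i2)" .
  qed
  also have "\<dots> \<le> (\<Sum>i1 = 0..s1. \<Sum>i2 = 0..s2. ?S i1 i2)"
    by (rule sum_mono2) (auto intro!: sum_nonneg)
  finally show ?thesis .
qed

lemma partial_sum_diff1: "(\<Sum>k\<in>{0<..n}. diff1 a k m) = a n m - a 0 m"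
  unfolding diff1_def by (rule sum_telescope_greaterThanAtMost)

lemma partial_sum_diff2: "(\<Sum>k\<in>{0<..n}. diff2 a m k) = a m n - a m 0"
  unfolding diff2_def by (rule sum_telescope_greaterThanAtMost)

lemma partial_sum_diff12:
  "(\<Sum>k1\<in>{0<..n1}. \<Sum>k2\<in>{0<..n2}. diff12 a k1 k2) = a n1 n2 - a 0 n2 - a n1 0 + a 0 0"
proof -
  \<comment> \<open>The mixed difference is the difference in the second variable of
    \<open>diff1\<close>, so one can telescope first in \<open>k2\<close>, then in
    \<open>k1\<close>.\<close>
  have "diff12 a k1 k2 = diff1 a k1 k2 - diff1 a k1 (k2 - 1)" for k1 k2
    by (simp add: diff12_def diff1_def)
  then have "(\<Sum>k2\<in>{0<..n2}. diff12 a k1 k2) = diff1 a k1 n2 - diff1 a k1 0" for k1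
    by (simp only: sum_telescope_greaterThanAtMost[of "diff1 a k1"])
  then show ?thesis
    by (simp add: sum_subtractf partial_sum_diff1)
qed

theorem lemma3p1:
  fixes a :: "nat \<Rightarrow> nat \<Rightarrow> complex"
    and s1 s2 m1 m2 :: nat
  assumes "m1 \<in> {0..2 ^ s1 - 1}" and "m2 \<in> {0..2 ^ s2 - 1}"
  shows "(SUP n1\<in>{0..<2 ^ s1}. SUP n2\<in>{0..<2 ^ s2}. cmod (a n1 n2))
    \<le> 8 * (\<Sum>i1 = 0..s1. \<Sum>i2 = 0..s2.
            sqrt (\<Sum>j1 = 1..2 ^ (s1 - i1). \<Sum>j2 = 1..2 ^ (s2 - i2).
              (cmod (\<Sum>k1\<in>dyadic i1 j1. \<Sum>k2\<in>dyadic i2 j2. diff12 a k1 k2))\<^sup>2))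
      + 2 * sqrt 2 * (\<Sum>i1 = 0..s1.
            sqrt (\<Sum>j1 = 1..2 ^ (s1 - i1). (cmod (\<Sum>k1\<in>dyadic i1 j1. diff1 a k1 m2))\<^sup>2))
      + 2 * sqrt 2 * (\<Sum>i2 = 0..s2.
            sqrt (\<Sum>j2 = 1..2 ^ (s2 - i2). (cmod (\<Sum>k2\<in>dyadic i2 j2. diff2 a m1 k2))\<^sup>2))
      + cmod (a m1 m2)"
    (is "_ \<le> 8 * ?D + 2 * sqrt 2 * ?D1 + 2 * sqrt 2 * ?D2 + _")
proof -
  have m: "m1 < 2 ^ s1" "m2 < 2 ^ s2"
    using assms by (simp_all add: le_diff_conv2 Suc_le_eq)
  have bound: "cmod (a n1 n2)
      \<le> 8 * ?D + 2 * sqrt 2 * ?D1 + 2 * sqrt 2 * ?D2 + cmod (a m1 m2)"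
    if n: "n1 < 2 ^ s1" "n2 < 2 ^ s2" for n1 n2
  proof -
    define g where "g x y = (\<Sum>k1\<in>{0<..x}. \<Sum>k2\<in>{0<..y}. diff12 a k1 k2)" for x y
    define g1 where "g1 x = (\<Sum>k\<in>{0<..x}. diff1 a k m2)" for x
    define g2 where "g2 y = (\<Sum>k\<in>{0<..y}. diff2 a m1 k)" for y
    have g: "cmod (g x y) \<le> ?D" if "x < 2 ^ s1" "y < 2 ^ s2" for x y
      unfolding g_def by (rule norm_partial_sum_le2[OF that])
    have g1: "cmod (g1 x) \<le> ?D1" if "x < 2 ^ s1" for x
      unfolding g1_def by (rule norm_partial_sum_le[OF that])
    have g2: "cmod (g2 y) \<le> ?D2" if "y < 2 ^ s2" for y
      unfolding g2_def by (rule norm_partial_sum_le[OF that])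
    \<comment> \<open>All values of \<open>a\<close> at index 0 cancel. The \<open>g\<close> terms
      give the mixed difference over the rectangle with corners \<open>(m1, m2)\<close> and
      \<open>(n1, n2)\<close>; the \<open>g1\<close> and \<open>g2\<close> terms give the
      differences along its two sides through \<open>(m1, m2)\<close>.\<close>
    have "a n1 n2 = (((((((g n1 n2 - g m1 n2) - g n1 m2) + g m1 m2)
        + g1 n1) - g1 m1) + g2 n2) - g2 m2) + a m1 m2"
      by (simp add: g_def g1_def g2_def partial_sum_diff1 partial_sum_diff2 partial_sum_diff12)
    also have "cmod \<dots> \<le> cmod (g n1 n2) + cmod (g m1 n2) + cmod (g n1 m2) + cmod (g m1 m2)
        + cmod (g1 n1) + cmod (g1 m1) + cmod (g2 n2) + cmod (g2 m2) + cmod (a m1 m2)"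
      by (intro norm_triangle_le norm_triangle_le_diff add_right_mono order_refl)
    also have "\<dots> \<le> 4 * ?D + 2 * ?D1 + 2 * ?D2 + cmod (a m1 m2)"
      using g[OF n] g[OF m(1) n(2)] g[OF n(1) m(2)] g[OF m] g1[OF n(1)] g1[OF m(1)]
        g2[OF n(2)] g2[OF m(2)] by linarith
    also have "\<dots> \<le> 8 * ?D + 2 * sqrt 2 * ?D1 + 2 * sqrt 2 * ?D2 + cmod (a m1 m2)"
    proof -
      have "0 \<le> ?D" "0 \<le> ?D1" "0 \<le> ?D2"
        by (intro sum_nonneg real_sqrt_ge_zero zero_le_power2)+
      moreover have "2 \<le> 2 * sqrt 2"
        by simp
      ultimately show ?thesis
        by (intro add_mono mult_right_mono order_refl) simp_all
    qed
    finally show ?thesis .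
  qed
  show ?thesis
    \<comment> \<open>Each supremum is over a nonempty set, so the uniform bound passes to
      both.\<close>
    by (intro cSUP_least bound) simp_all
qed

end
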